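(* Let $\mathcal B=\{\boldsymbol{q}\in\mathbb{R}^2\mid C\boldsymbol{q}\le\boldsymbol{d}\}$ and $\mathcal O=\{\boldsymbol{q}\in\mathbb{R}^2\mid A\boldsymbol{q}\le\boldsymbol{b}\}$ be two bounded convex polygons, where $C\in\mathbb{R}^{M\times 2}$, $\boldsymbol{d}\in\mathbb{R}^{M}$, $A\in\mathbb{R}^{N\times 2}$, $\boldsymbol{b}\in\mathbb{R}^{N}$. Let $V=[\boldsymbol{v}_1,\ldots,\boldsymbol{v}_M]\in\mathbb{R}^{2\times M}$ and $O=[\boldsymbol{o}_1,\ldots,\boldsymbol{o}_N]\in\mathbb{R}^{2\times N}$ be the matrices whose columns are the vertices of $\mathcal B$ and of $\mathcal O$, respectively. Then $\mathcal B\cap\mathcal O=\emptyset$ if and only if there exist matrices $\Lambda\in\mathbb{R}^{M\times N}$ and $\Omega\in\mathbb{R}^{N\times M}$ with $\Lambda\succeq 0_{M,N}$ and $\Omega\succeq 0_{N,M}$ such that $$(CO-\boldsymbol{d}\boldsymbol{1}^{\top})^{\top}\Lambda\succ 0_{N,N}\quad\text{and}\quad (AV-\boldsymbol{b}\boldsymbol{1}^{\top})^{\top}\Omega\succ 0_{M,M}.$$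
   Context: The symbols $\succeq$ and $\succ$ between matrices denote elementwise (entry-by-entry) inequalities $\ge$ and $>$ (not semidefinite orderings); $\le$ between vectors is componentwise. $0_{k,l}$ is the $k\times l$ zero matrix, and $\boldsymbol{1}=(1,\ldots,1)^\top$ is the all-ones column vector of the appropriate length ($N$ in $\boldsymbol{d}\boldsymbol{1}^\top$, $M$ in $\boldsymbol{b}\boldsymbol{1}^\top$). A convex polygon is a genuine polygon (in particular nonempty) whose describing inequalities are ordered one per edge, so that the number of vertices equals the number of rows: with $\boldsymbol{c}_i^\top$ the $i$-th row of $C$, the vertex $\boldsymbol{v}_i$ is the point of intersection of the lines $\boldsymbol{c}_i^\top\boldsymbol{q}=d_i$ and $\boldsymbol{c}_{i+1}^\top\boldsymbol{q}=d_{i+1}$ (indices cyclic modulo $M$), and similarly $\boldsymbol{o}_j$ is the intersection of $\boldsymbol{a}_j^\top\boldsymbol{q}=b_j$ and $\boldsymbol{a}_{j+1}^\top\boldsymbol{q}=b_{j+1}$ (indices cyclic modulo $N$), with $\boldsymbol{a}_j^\top$ the $j$-th row of $A$. *)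

theory Defs
  imports "HOL-Analysis.Analysis"
begin

definition halfplanes :: "real^2^'m \<Rightarrow> real^'m \<Rightarrow> (real^2) set" where
  "halfplanes C d = {q. C *v q \<le> d}"

definition row_line :: "real^2^'m \<Rightarrow> real^'m \<Rightarrow> 'm \<Rightarrow> (real^2) set" where
  "row_line C d i = {q. row i C \<bullet> q = d $ i}"

(* A finite linearly ordered index type with M elements is the index set 1 < ... < M;
   this is the map i \<mapsto> i + 1 modulo M, which sends the greatest index to the least one. *)
definition cyclic_next :: "'m::{finite,linorder} \<Rightarrow> 'm" where
  "cyclic_next i = (if \<exists>j. i < j then Min {j. i < j} else Min UNIV)"

(* The rows correspond one to one to the edges, and edges of cyclically
   consecutive rows meet. *)
definition convex_polygon :: "real^2^('m::{finite,linorder}) \<Rightarrow> real^('m::_) \<Rightarrow> bool" where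
  "convex_polygon C d \<longleftrightarrow>
     bounded (halfplanes C d) \<and>
     aff_dim (halfplanes C d) = 2 \<and>
     bij_betw (\<lambda>i. halfplanes C d \<inter> row_line C d i) UNIV {F. F edge_of halfplanes C d} \<and>
     (\<forall>i. halfplanes C d \<inter> row_line C d i \<inter> row_line C d (cyclic_next i) \<noteq> {})"

(* For a convex polygon the second conjunct already determines V and implies the first. *)
definition vertex_matrix :: "real^2^('m::{finite,linorder}) \<Rightarrow> real^('m::_) \<Rightarrow> real^('m::_)^2 \<Rightarrow> bool" where
  "vertex_matrix C d V \<longleftrightarrow>
     bij_betw (\<lambda>i. column i V) UNIV {v. v extreme_point_of halfplanes C d} \<and>
     (\<forall>i. row_line C d i \<inter> row_line C d (cyclic_next i) = {column i V})"

end

theory Submission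
  imports Defs
begin

text \<open>
  For a finite set of points \<open>o\<^sub>j\<close>, Ville's theorem of the alternative says that either some
  nonnegative combination \<open>\<lambda>\<close> of the inequalities \<open>C q \<le> d\<close> is violated at all \<open>o\<^sub>j\<close>, or some
  convex combination of the \<open>o\<^sub>j\<close> satisfies all of them, i.e. lies in \<open>\<B>\<close>. As \<open>\<O>\<close> is the
  convex hull of its vertices, applying this to the vertices of \<open>\<O>\<close> shows that a single nonnegative
  \<open>\<lambda>\<close> certifies disjointness, and \<open>\<Lambda>\<close> can be taken to have all its columns equal to \<open>\<lambda>\<close>.
  The matrix \<open>\<Omega>\<close> is obtained by exchanging the two polygons.
\<close>

text \<open>The compact hull is strictly separated from the closed nonpositive orthant. The normal
  \<open>a\<close> of the separating hyperplane serves as \<open>l\<close>: the origin lies in the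
  orthant, so the level \<open>r\<close> is positive, and \<open>a\<close> exceeds it on the
  hull.\<close>

lemma Ville_alternative:
  fixes g :: "'n::finite \<Rightarrow> real^'m"
  assumes "convex hull (range g) \<inter> {x. x \<le> 0} = {}"
  obtains l :: "real^'m" where "0 \<le> l" "\<And>j. 0 < l \<bullet> g j"
proof -
  let ?P = "{x :: real^'m. x \<le> 0}"
  have "?P = (\<Inter>i. {x. axis i 1 \<bullet> x \<le> 0})"
    by (auto simp: less_eq_vec_def inner_axis')
  then have "closed ?P" "convex ?P"
    by (auto intro!: closed_INT closed_halfspace_le convex_INT convex_halfspace_le)
  moreover have "compact (convex hull (range g))"
    by (simp add: finite_imp_compact_convex_hull)
  ultimately obtain a r where P: "\<And>x. x \<in> ?P \<Longrightarrow> a \<bullet> x < r"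
    and K: "\<And>x. x \<in> convex hull (range g) \<Longrightarrow> r < a \<bullet> x"
    using separating_hyperplane_closed_compact[of ?P "convex hull (range g)"] assms
    by (metis Int_commute convex_convex_hull convex_hull_eq_empty image_is_empty UNIV_not_empty)
  have "0 < r"
    using P[of 0] by simp
  have "0 \<le> a $ i" for i
  proof (rule ccontr)
    assume "\<not> 0 \<le> a $ i"
    \<comment> \<open>If \<open>a $ i\<close> were negative, this point on the \<open>i\<close>-th
      axis would lie in the orthant, yet \<open>a\<close> takes exactly the value \<open>r\<close>
      there.\<close>
    moreover have "a \<bullet> axis i (r / a $ i) < r"
      by (rule P) (use \<open>0 < r\<close> calculation in
          \<open>auto simp: less_eq_vec_def axis_def divide_nonneg_nonpos\<close>)
    ultimately show False
      by (simp add: inner_axis)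
  qed
  moreover have "0 < a \<bullet> g j" for j
    using K[of "g j"] \<open>0 < r\<close> hull_subset[of "range g" convex] by fastforce
  ultimately show thesis
    using that[of a] by (simp add: less_eq_vec_def)
qed

lemma mem_halfplanes: "q \<in> halfplanes C d \<longleftrightarrow> (\<forall>i. row i C \<bullet> q \<le> d $ i)"
  by (simp add: halfplanes_def less_eq_vec_def matrix_vector_mul_component row_def)

lemma halfplanes_eq_INT: "halfplanes C d = (\<Inter>i. {q. row i C \<bullet> q \<le> d $ i})"
  by (auto simp: mem_halfplanes)

lemma convex_halfplanes: "convex (halfplanes C d)"
  unfolding halfplanes_eq_INT by (intro convex_INT convex_halfspace_le)

lemma closed_halfplanes: "closed (halfplanes C d)"
  unfolding halfplanes_eq_INT by (intro closed_INT ballI closed_halfspace_le)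

text \<open>By Minkowski's theorem a compact convex set is the convex hull of its extreme points,
  which here are the columns of \<open>V\<close>.\<close>

lemma halfplanes_eq_hull_vertices:
  fixes A :: "real^2^('n::{finite,linorder})" and b :: "real^('n::_)"
  assumes "convex_polygon A b" "vertex_matrix A b V"
  shows "halfplanes A b = convex hull (range (\<lambda>j. column j V))"
proof -
  have "compact (halfplanes A b)"
    using assms(1) by (simp add: convex_polygon_def compact_eq_bounded_closed closed_halfplanes)
  then show ?thesis
    using Krein_Milman_Minkowski[OF _ convex_halfplanes] assms(2)
    by (simp add: vertex_matrix_def bij_betw_def)
qed

text \<open>The matrix inequality thereby decouples: each column of \<open>L\<close> is a separate
  weight vector tested against all the points \<open>column j V\<close>.\<close>

lemma slack_matrix_mult_component:
  fixes C :: "real^2^('m::finite)" and V :: "real^('n::finite)^2" and L :: "real^('k::finite)^'m"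
  shows "(transpose (C ** V - (columnvector d :: real^1^'m) ** rowvector (1 :: real^'n)) ** L) $ j $ k
    = column k L \<bullet> (C *v column j V - d)"
  by (simp add: matrix_matrix_mult_def transpose_def columnvector_def rowvector_def
      inner_vec_def column_def matrix_vector_mult_def mult.commute)

lemma disjoint_iff_separating_matrix:
  fixes C :: "real^2^('m::finite)" and V :: "real^('n::finite)^2"
  assumes S: "S = convex hull (range (\<lambda>j. column j V))"
  shows "halfplanes C d \<inter> S = {} \<longleftrightarrow>
    (\<exists>L :: real^('k::finite)^'m. (\<forall>i k. 0 \<le> L $ i $ k) \<and>
      (\<forall>j k. 0 < (transpose (C ** V - (columnvector d :: real^1^'m)
        ** rowvector (1 :: real^'n)) ** L) $ j $ k))"
    (is "_ \<longleftrightarrow> (\<exists>L. ?nonneg L \<and> ?pos L)")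
proof
  \<comment> \<open>This affine map sends \<open>q\<close> into the nonpositive orthant exactly when
    \<open>q\<close> lies in \<open>halfplanes C d\<close>, and it commutes with convex
    hulls.\<close>
  let ?f = "\<lambda>q. C *v q - d"
  assume disj: "halfplanes C d \<inter> S = {}"
  have "?f ` S = convex hull (range (\<lambda>j. ?f (column j V)))"
  proof -
    have "?f ` S = (\<lambda>x. - d + x) ` (*v) C ` S"
      by (simp add: image_image)
    also have "\<dots> = convex hull ((\<lambda>x. - d + x) ` (*v) C ` range (\<lambda>j. column j V))"
      by (simp only: S convex_hull_linear_image[OF matrix_vector_mul_linear] convex_hull_translation)
    finally show ?thesis
      by (simp add: image_image)
  qed
  moreover have "?f ` S \<inter> {x. x \<le> 0} = {}"
    using disj by (auto simp: halfplanes_def)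
  ultimately obtain l where "0 \<le> l" and "\<And>j. 0 < l \<bullet> ?f (column j V)"
    using Ville_alternative by metis
  moreover have "column k (\<chi> i k. l $ i) = l" for k :: 'k
    by (simp add: column_def)
  ultimately have "?nonneg (\<chi> i k. l $ i) \<and> ?pos (\<chi> i k. l $ i)"
    by (simp add: slack_matrix_mult_component less_eq_vec_def)
  then show "\<exists>L. ?nonneg L \<and> ?pos L" ..
next
  assume "\<exists>L :: real^'k^'m. ?nonneg L \<and> ?pos L"
  then obtain L :: "real^'k^'m" where L: "?nonneg L" "?pos L"
    by blast
  \<comment> \<open>Types are nonempty, so there is a column, and any one of them certifies
    disjointness.\<close>
  fix k :: 'k
  define l where "l = column k L"
  have pos: "l \<bullet> d < l \<bullet> (C *v column j V)" for j
    using L(2) by (simp add: slack_matrix_mult_component l_def inner_diff_right)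
  \<comment> \<open>This set is an open half-plane (or trivial) with normal \<open>l v* C\<close>;
    it will contain \<open>S\<close> and miss \<open>halfplanes C d\<close>.\<close>
  have "convex {q. l \<bullet> d < l \<bullet> (C *v q)}"
    using convex_halfspace_gt[of "l \<bullet> d" "l v* C"] by (simp add: dot_lmul_matrix)
  then have "S \<subseteq> {q. l \<bullet> d < l \<bullet> (C *v q)}"
    unfolding S using pos by (intro hull_minimal) auto
  moreover have "l \<bullet> (C *v q) \<le> l \<bullet> d" if "q \<in> halfplanes C d" for q
    using that L(1) unfolding inner_vec_def
    by (intro sum_mono) (auto simp: halfplanes_def less_eq_vec_def l_def column_def
        intro: mult_left_mono)
  ultimately show "halfplanes C d \<inter> S = {}"
    by force
qed

theorem proposition2:
  fixes C :: "real^2^('m::{finite,linorder})" and d :: "real^('m::_)"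
    and A :: "real^2^('n::{finite,linorder})" and b :: "real^('n::_)"
    and V :: "real^('m::_)^2" and Ob :: "real^('n::_)^2"
  assumes "convex_polygon C d" and "convex_polygon A b"
    and "vertex_matrix C d V" and "vertex_matrix A b Ob"
  shows "halfplanes C d \<inter> halfplanes A b = {} \<longleftrightarrow>
    (\<exists>(\<Lambda> :: real^('n::_)^('m::_)) (\<Omega> :: real^('m::_)^('n::_)).
       (\<forall>i j. 0 \<le> \<Lambda> $ i $ j) \<and>
       (\<forall>j i. 0 \<le> \<Omega> $ j $ i) \<and>
       (\<forall>j k. 0 < (transpose (C ** Ob - (columnvector d :: real^1^('m::_)) ** rowvector (1 :: real^('n::_))) ** \<Lambda>) $ j $ k) \<and>
       (\<forall>i k. 0 < (transpose (A ** V - (columnvector b :: real^1^('n::_)) ** rowvector (1 :: real^('m::_))) ** \<Omega>) $ i $ k))"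
  \<comment> \<open>The existence of \<Lambda> and that of \<Omega> are each equivalent to
    disjointness, hence so is their conjunction.\<close>
  using disjoint_iff_separating_matrix[OF halfplanes_eq_hull_vertices[OF assms(2,4)],
      where C = C and d = d and 'k = 'n]
    disjoint_iff_separating_matrix[OF halfplanes_eq_hull_vertices[OF assms(1,3)],
      where C = A and d = b and 'k = 'm]
  unfolding Int_commute[of "halfplanes A b"] by blast

end
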